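(* Let $\mathcal{W}$ be the Witt algebra over $\mathbb{C}$. Then its first and second Leibniz cohomology groups with coefficients in itself vanish: $HL^i(\mathcal{W},\mathcal{W})=0$ for $i=1,2$.
   Context: All algebras are over the field $\mathbb{C}$ of complex numbers. The Witt algebra $\mathcal{W}$ is the Lie algebra of derivations of $\mathbb{C}[z,z^{-1}]$; it has (algebraic) basis $\{d_j\mid j\in\mathbb{Z}\}$, $d_j=-z^{j+1}\frac{d}{dz}$, with $[d_m,d_n]=(m-n)d_{m+n}$ for $m,n\in\mathbb{Z}$. A Leibniz algebra is a vector space $L$ with a bilinear product satisfying $[x,[y,z]]=[[x,y],z]-[[x,z],y]$ for all $x,y,z\in L$; every Lie algebra is a Leibniz algebra. Leibniz cohomology $HL^*(L,L)$ is that of Loday and Pirashvili, with all cochains being arbitrary (multi)linear maps, with no skew-symmetry or continuity required. In degree 1, $HL^1(L,L)$ is the quotient of the space of derivations of $L$, i.e. linear maps $d:L\to L$ with $d([x,y])=[d(x),y]+[x,d(y)]$ for all $x,y\in L$, by the space of inner derivations $x\mapsto[x,a]$, $a\in L$. In degree 2, $HL^2(L,L)=ZL^2(L,L)/BL^2(L,L)$. Here $ZL^2(L,L)$ is the space of bilinear maps $\varphi:L\times L\to L$ with $$[x,\varphi(y,z)]-[\varphi(x,y),z]+[\varphi(x,z),y]+\varphi(x,[y,z])-\varphi([x,y],z)+\varphi([x,z],y)=0$$ for all $x,y,z\in L$, and $BL^2(L,L)$ is the space of bilinear maps of the form $$f(x,y)=[d(x),y]+[x,d(y)]-d([x,y])$$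 for some linear map $d:L\to L$. *)

theory Defs
  imports Complex_Main "HOL-Library.Poly_Mapping"
begin

section \<open>Leibniz algebras and their cohomology in degrees 1 and 2\<close>

definition bilinear_map ::
    "('k::field \<Rightarrow> 'a::ab_group_add \<Rightarrow> 'a) \<Rightarrow> ('a \<Rightarrow> 'a \<Rightarrow> 'a) \<Rightarrow> bool"
  where "bilinear_map s f \<longleftrightarrow>
    (\<forall>x. Vector_Spaces.linear s s (\<lambda>y. f x y)) \<and> (\<forall>y. Vector_Spaces.linear s s (\<lambda>x. f x y))"

locale leibniz_algebra = vector_space scale
  for scale :: "complex \<Rightarrow> 'a::ab_group_add \<Rightarrow> 'a" +
  fixes bracket :: "'a \<Rightarrow> 'a \<Rightarrow> 'a"
  assumes bilinear_bracket: "bilinear_map scale bracket"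
    and leibniz: "bracket x (bracket y z) = bracket (bracket x y) z - bracket (bracket x z) y"
begin

definition ZL1 :: "('a \<Rightarrow> 'a) set"
  where "ZL1 = {d. Vector_Spaces.linear scale scale d \<and>
    (\<forall>x y. d (bracket x y) = bracket (d x) y + bracket x (d y))}"

definition BL1 :: "('a \<Rightarrow> 'a) set"
  where "BL1 = {d. \<exists>a. d = (\<lambda>x. bracket x a)}"

definition ZL2 :: "('a \<Rightarrow> 'a \<Rightarrow> 'a) set"
  where "ZL2 = {f. bilinear_map scale f \<and>
    (\<forall>x y z. bracket x (f y z) - bracket (f x y) z + bracket (f x z) y
      + f x (bracket y z) - f (bracket x y) z + f (bracket x z) y = 0)}"

definition BL2 :: "('a \<Rightarrow> 'a \<Rightarrow> 'a) set"
  where "BL2 = {f. \<exists>d. Vector_Spaces.linear scale scale d \<and>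
    f = (\<lambda>x y. bracket (d x) y + bracket x (d y) - d (bracket x y))}"

text \<open>The quotient spaces are represented by their sets of classes. Since coboundaries are cocycles
  (see below), the zero classes are \<open>BL1\<close> and \<open>BL2\<close>.\<close>

definition HL1 :: "('a \<Rightarrow> 'a) set set"
  where "HL1 = ZL1 // {(f, g). f \<in> ZL1 \<and> g \<in> ZL1 \<and> (\<lambda>x. f x - g x) \<in> BL1}"

definition HL2 :: "('a \<Rightarrow> 'a \<Rightarrow> 'a) set set"
  where "HL2 = ZL2 // {(f, g). f \<in> ZL2 \<and> g \<in> ZL2 \<and> (\<lambda>x y. f x y - g x y) \<in> BL2}"

lemma linear_bracket:
  "Vector_Spaces.linear scale scale (\<lambda>y. bracket x y)"
  "Vector_Spaces.linear scale scale (\<lambda>x. bracket x y)"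
  using bilinear_bracket by (auto simp: bilinear_map_def)

lemma linear_scale_iff:
  "Vector_Spaces.linear scale scale f \<longleftrightarrow>
    (\<forall>x y. f (x + y) = f x + f y) \<and> (\<forall>c x. f (scale c x) = scale c (f x))"
  by (simp add: Vector_Spaces.linear_iff vector_space_axioms)

lemma linear_diff:
  assumes "Vector_Spaces.linear scale scale f"
  shows "f (x - y) = f x - f y"
  by (rule module_hom.diff[OF assms[unfolded linear_iff_module_hom]])

lemmas bracket_simps =
  linear_bracket[unfolded linear_scale_iff, THEN conjunct1, rule_format]
  linear_bracket[unfolded linear_scale_iff, THEN conjunct2, rule_format]
  linear_diff[OF linear_bracket(1)] linear_diff[OF linear_bracket(2)]

lemma BL1_subset_ZL1: "BL1 \<subseteq> ZL1"
  using linear_bracket by (auto simp: BL1_def ZL1_def leibniz)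

lemma BL2_subset_ZL2: "BL2 \<subseteq> ZL2"
proof
  fix f assume "f \<in> BL2"
  then obtain d where d: "Vector_Spaces.linear scale scale d"
    and f: "f = (\<lambda>x y. bracket (d x) y + bracket x (d y) - d (bracket x y))"
    by (auto simp: BL2_def)
  have d_simps: "d (x + y) = d x + d y" "d (scale c x) = scale c (d x)" "d (x - y) = d x - d y"
    for x y c using d linear_diff[OF d] by (auto simp: linear_scale_iff)
  have "bilinear_map scale f"
    unfolding bilinear_map_def linear_scale_iff f
    by (simp add: bracket_simps d_simps algebra_simps)
  moreover have "bracket x (f y z) - bracket (f x y) z + bracket (f x z) y
      + f x (bracket y z) - f (bracket x y) z + f (bracket x z) y = 0" for x y z
    unfolding f by (simp add: bracket_simps d_simps leibniz algebra_simps)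
  ultimately show "f \<in> ZL2" by (simp add: ZL2_def)
qed

end

section \<open>The Witt algebra\<close>

text \<open>The convolution product on finitely supported functions on the integers makes
  \<open>int \<Rightarrow>\<^sub>0 complex\<close> the algebra of Laurent polynomials, the function
  \<open>Poly_Mapping.single n 1\<close> being the \<open>n\<close>-th power of the variable.\<close>

type_synonym laurent_poly = "int \<Rightarrow>\<^sub>0 complex"

definition laurent_scale :: "complex \<Rightarrow> laurent_poly \<Rightarrow> laurent_poly"
  where "laurent_scale c p = Poly_Mapping.single 0 c * p"

lemma vector_space_laurent: "vector_space laurent_scale"
proof
  show "laurent_scale a (laurent_scale b p) = laurent_scale (a * b) p" for a b p
    by (simp add: laurent_scale_def mult_single flip: mult.assoc)
qed (simp_all add: laurent_scale_def algebra_simps single_add)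

interpretation laurent: vector_space laurent_scale
  by (rule vector_space_laurent)

lemma laurent_scale_mult:
  "laurent_scale c p * q = laurent_scale c (p * q)"
  "p * laurent_scale c q = laurent_scale c (p * q)"
  by (simp_all add: laurent_scale_def ac_simps)

definition laurent_derivation :: "(laurent_poly \<Rightarrow> laurent_poly) \<Rightarrow> bool"
  where "laurent_derivation D \<longleftrightarrow> Vector_Spaces.linear laurent_scale laurent_scale D \<and>
    (\<forall>p q. D (p * q) = D p * q + p * D q)"

lemma laurent_derivation_iff:
  "laurent_derivation D \<longleftrightarrow> (\<forall>p q. D (p + q) = D p + D q) \<and>
    (\<forall>c p. D (laurent_scale c p) = laurent_scale c (D p)) \<and>
    (\<forall>p q. D (p * q) = D p * q + p * D q)"
  by (simp add: laurent_derivation_def Vector_Spaces.linear_iff vector_space_laurent)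

lemma laurent_derivation_diff: "laurent_derivation D \<Longrightarrow> D (p - q) = D p - D q"
  unfolding laurent_derivation_iff by (metis add_diff_cancel_right' diff_add_cancel)

typedef witt = "{D. laurent_derivation D}"
  morphisms witt_apply Abs_witt
proof
  show "(\<lambda>p. 0) \<in> {D. laurent_derivation D}"
    by (simp add: laurent_derivation_iff algebra_simps)
qed

setup_lifting type_definition_witt

instantiation witt :: ab_group_add
begin

lift_definition zero_witt :: witt is "\<lambda>p. 0"
  by (simp add: laurent_derivation_iff algebra_simps)

lift_definition plus_witt :: "witt \<Rightarrow> witt \<Rightarrow> witt" is "\<lambda>D E p. D p + E p"
  by (simp add: laurent_derivation_iff laurent_scale_mult
    laurent.scale_left_commute algebra_simps)

lift_definition minus_witt :: "witt \<Rightarrow> witt \<Rightarrow> witt" is "\<lambda>D E p. D p - E p"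
  by (simp add: laurent_derivation_iff laurent_scale_mult
    laurent.scale_left_commute algebra_simps)

lift_definition uminus_witt :: "witt \<Rightarrow> witt" is "\<lambda>D p. - D p"
  by (simp add: laurent_derivation_iff laurent_scale_mult
    laurent.scale_left_commute algebra_simps)

instance
  by standard (transfer; simp add: algebra_simps)+

end

lift_definition witt_scale :: "complex \<Rightarrow> witt \<Rightarrow> witt" is "\<lambda>c D p. laurent_scale c (D p)"
  by (simp add: laurent_derivation_iff laurent_scale_mult
    laurent.scale_left_commute algebra_simps)

lift_definition witt_bracket :: "witt \<Rightarrow> witt \<Rightarrow> witt" is "\<lambda>D E p. D (E p) - E (D p)"
  by (simp add: laurent_derivation_iff laurent_scale_mult
    laurent.scale_left_commute algebra_simps)

interpretation witt: leibniz_algebra witt_scale witt_bracket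
proof -
  have vs: "vector_space witt_scale"
  proof
    fix a b :: complex and x y :: witt
    show "witt_scale a (x + y) = witt_scale a x + witt_scale a y"
      by transfer (simp add: laurent.scale_right_distrib)
    show "witt_scale (a + b) x = witt_scale a x + witt_scale b x"
      by transfer (simp add: laurent.scale_left_distrib)
    show "witt_scale a (witt_scale b x) = witt_scale (a * b) x" "witt_scale 1 x = x"
      by (transfer, simp)+
  qed
  have "witt_bracket x (y + z) = witt_bracket x y + witt_bracket x z" for x y z
    by transfer (simp add: laurent_derivation_iff algebra_simps)
  moreover have "witt_bracket (y + z) x = witt_bracket y x + witt_bracket z x" for x y z
    by transfer (simp add: laurent_derivation_iff algebra_simps)
  moreover have "witt_bracket x (witt_scale c y) = witt_scale c (witt_bracket x y)" for x y c
    by transfer (simp add: laurent_derivation_iff algebra_simps)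
  moreover have "witt_bracket (witt_scale c y) x = witt_scale c (witt_bracket y x)" for x y c
    by transfer (simp add: laurent_derivation_iff algebra_simps)
  ultimately have "bilinear_map witt_scale witt_bracket"
    by (simp add: bilinear_map_def Vector_Spaces.linear_iff vs)
  moreover have "witt_bracket x (witt_bracket y z)
      = witt_bracket (witt_bracket x y) z - witt_bracket (witt_bracket x z) y" for x y z
    by transfer (simp add: laurent_derivation_diff algebra_simps)
  ultimately show "leibniz_algebra witt_scale witt_bracket"
    using vs by (simp add: leibniz_algebra_def leibniz_algebra_axioms_def)
qed

end

theory Submission imports Defs begin

text \<open>Write \<open>e\<^sub>n = z\<^sup>n\<^sup>+\<^sup>1 d/dz = - d\<^sub>n\<close>, so that \<open>[e\<^sub>i, e\<^sub>j] = (j - i) e\<^sub>i\<^sub>+\<^sub>j\<close>. The coefficient of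
  \<open>e\<^sub>i\<^sub>+\<^sub>j\<^sub>+\<^sub>d\<close> in a cocycle evaluated at \<open>(e\<^sub>i, e\<^sub>j)\<close> gives, for each degree \<open>d\<close>, a scalar cocycle, and
  these can be treated one degree at a time. Evaluating the Leibniz cocycle condition at
  \<open>(x, y, y)\<close> shows that \<open>\<phi>(y, y)\<close> is central, hence zero, so 2-cocycles are alternating. In degree
  \<open>d \<noteq> 0\<close> the action of \<open>e\<^sub>0\<close> is multiplication by \<open>d\<close> and contraction with \<open>e\<^sub>0\<close> yields an explicit
  primitive \<open>- C i 0 / d\<close>; as \<open>\<phi>(e\<^sub>i, e\<^sub>0)\<close> has only finitely many coefficients, the primitives of all
  degrees assemble to a linear map even though the cocycle may have infinitely many nonzero degrees.
  In degree 0 one subtracts a coboundary to get \<open>C i 1 = 0\<close> and \<open>C 2 (-1) = 0\<close> (Schlichenmaier's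
  normalization); the cocycle condition then forces \<open>C = 0\<close>. Derivations are handled likewise.\<close>

section \<open>Scalar cocycles\<close>

text \<open>Additivity is available only for distinct arguments, so 2 = 1 + 1 is not usable. The
  value at 2 comes from 1 = 2 + (-1), once the downward induction has reached -1.\<close>

lemma additive_on_distinct_int:
  fixes c :: "int \<Rightarrow> complex"
  assumes "\<And>i j. of_int (j - i) * (c (i + j) - c i - c j) = 0"
  shows "c i = of_int i * c 1"
proof -
  define g where "g i = c i - of_int i * c 1" for i
  have add: "g (i + j) = g i + g j" if "i \<noteq> j" for i j
  proof -
    have "c (i + j) - c i - c j = 0" using assms[of j i] that by simp
    then show ?thesis by (simp add: g_def algebra_simps)
  qed
  have g1: "g 1 = 0" by (simp add: g_def)
  have g0: "g 0 = 0" using add[of 0 1] by simp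
  have le: "g i = 0" if "i \<le> 1" for i
    using that
  proof (induction i rule: int_le_induct)
    case (step i)
    then show ?case using add[of 1 "i - 1"] g1 by simp
  qed (rule g1)
  have "g (- 1) = 0" by (rule le) simp
  then have g2: "g 2 = 0" using add[of 2 "- 1"] g1 by simp
  have ge: "g i = 0" if "2 \<le> i" for i
    using that
  proof (induction i rule: int_ge_induct)
    case (step i)
    then show ?case using add[of i 1] g1 by simp
  qed (rule g2)
  have "g i = 0" using le[of i] ge[of i] by linarith
  then show ?thesis by (simp add: g_def)
qed

text \<open>The equations satisfied by the structure constants \<open>C i j\<close> of an alternating cocycle
  mapping \<open>(e\<^sub>i, e\<^sub>j)\<close> to \<open>C i j e\<^sub>i\<^sub>+\<^sub>j\<^sub>+\<^sub>d\<close>, where \<open>[e\<^sub>i, e\<^sub>j] = (j - i) e\<^sub>i\<^sub>+\<^sub>j\<close>.\<close>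

locale degree_cocycle =
  fixes d :: int and C :: "int \<Rightarrow> int \<Rightarrow> complex"
  assumes anti: "C i j = - C j i"
    and cocycle: "of_int (j + k + d - i) * C j k + of_int (i + j + d - k) * C i j
      - of_int (i + k + d - j) * C i k + of_int (k - j) * C i (j + k)
      - of_int (j - i) * C (i + j) k + of_int (k - i) * C (i + k) j = 0"

text \<open>For \<open>k = 0\<close> the multiples of \<open>C i j\<close> in the identity add up to
  (i + j + d) - j - i = d, and every other term is a multiple of some \<open>C m 0\<close>.\<close>

lemma (in degree_cocycle) nonzero_degree_coboundary:
  assumes "d \<noteq> 0"
  defines "b \<equiv> \<lambda>i. - C i 0 / of_int d"
  shows "C i j = of_int (j + d - i) * b j - of_int (i + d - j) * b i - of_int (j - i) * b (i + j)"
proof -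
  \<comment> \<open>\<open>cocycle\<close> takes its instances in the order \<open>j\<close>,
    \<open>k\<close>, \<open>i\<close>.\<close>
  have "of_int d * C i j = - (of_int (j + d - i) * C j 0) + of_int (i + d - j) * C i 0
    + of_int (j - i) * C (i + j) 0"
    using cocycle[of j 0 i] by (simp add: algebra_simps)
  moreover have "of_int d * b m = - C m 0" for m
    using assms(1) by (simp add: b_def)
  ultimately have "of_int d * C i j = of_int d *
      (of_int (j + d - i) * b j - of_int (i + d - j) * b i - of_int (j - i) * b (i + j))"
    by (simp only: right_diff_distrib mult.left_commute[of "of_int d"]) simp
  then show ?thesis
    using assms(1) by simp
qed

text \<open>The identities with \<open>k = 1\<close> and \<open>k = - 1\<close> carry vanishing from
  one column \<open>C _ j\<close> to the next. Their coefficients \<open>1 - j\<close> and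
  \<open>j + 1\<close> vanish at 1 and -1, so columns 2 and -2 need arguments of their own.\<close>

lemma normalized_degree_zero_cocycle_eq_0:
  assumes "degree_cocycle 0 C" and C1: "\<And>i. C i 1 = 0" and norm: "C 2 (- 1) = 0"
  shows "C i j = 0"
proof -
  interpret degree_cocycle 0 C by fact
  have diag: "C i i = 0" for i using anti[of i i] by simp
  \<comment> \<open>For \<open>k = 0\<close> in degree 0 the multiples of \<open>C i j\<close>
    cancel, which leaves additivity of \<open>C _ 0\<close> on distinct integers.\<close>
  have C0: "C i 0 = 0" for i
  proof -
    have "C i 0 = of_int i * C 1 0"
    proof (rule additive_on_distinct_int)
      show "of_int (j - i) * (C (i + j) 0 - C i 0 - C j 0) = 0" for i j
        using cocycle[of j 0 i] anti[of j i] by (simp add: algebra_simps)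
    qed
    then show ?thesis using C1[of 0] anti[of 0 1] by simp
  qed
  have up: "of_int (1 - i) * C (i + 1) j + of_int (1 - j) * C i (j + 1)
      + of_int (i + j - 1) * C i j = 0" for i j
    using cocycle[of j 1 i] C1 anti[of "i + 1" j] by (simp add: algebra_simps)
  have Cm1: "C i (- 1) = 0" for i
  proof -
    \<comment> \<open>At \<open>i = 1\<close> the left coefficient is 0, so the recursion does not
      pass from 1 to 2; \<open>norm\<close> restarts it at 2.\<close>
    have r: "of_int (1 - i) * C (i + 1) (- 1) = of_int (2 - i) * C i (- 1)" for i
      using up[of i "- 1"] C0 by (simp add: algebra_simps)
    have "C i (- 1) = 0" if "i \<le> 1" for i
      using that
    proof (induction i rule: int_le_induct)
      case base
      then show ?case using C1[of "- 1"] anti[of 1 "- 1"] by simp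
    next
      case (step i)
      then show ?case using r[of "i - 1"]
        by (smt (verit) mult_eq_0_iff of_int_eq_0_iff diff_add_cancel mult_zero_right)
    qed
    moreover have "C i (- 1) = 0" if "2 \<le> i" for i
      using that
    proof (induction i rule: int_ge_induct)
      case (step i)
      then show ?case using r[of i]
        by (smt (verit) mult_eq_0_iff of_int_eq_0_iff mult_zero_right)
    qed (rule norm)
    ultimately show ?thesis by (cases "i \<le> 1") auto
  qed
  have down: "of_int (i + 1) * C (i - 1) j + of_int (j + 1) * C i (j - 1)
      = of_int (i + j + 1) * C i j" for i j
    using cocycle[of j "- 1" i] Cm1 anti[of "i - 1" j] by (simp add: algebra_simps)
  have r2: "of_int (i + 3) * C i 2 = of_int (i + 1) * C (i - 1) 2" for i
    using down[of i 2] C1 by (simp add: algebra_simps)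
  have rm2: "of_int (1 - i) * C (i + 1) (- 2) = of_int (3 - i) * C i (- 2)" for i
    using up[of i "- 2"] Cm1 by (simp add: algebra_simps)
  \<comment> \<open>In \<open>r2\<close> at -1 this entry has coefficient 0, so the recursion from
    above does not reach it. The identity for the triple (2, -2, 3) reduces to 4 *
    \<open>C (- 2) 2\<close> = 0.\<close>
  have "C (- 2) 2 = 0"
  proof -
    have "C 3 (- 2) = C (- 2) 2"
      using rm2[of 2] anti[of 2 "- 2"] by simp
    moreover have "C 5 (- 2) = 0"
      using rm2[of 3] rm2[of 4] by simp
    moreover have "C 3 2 = 0" "C 1 2 = 0" "C 0 3 = 0"
      using r2[of 3] diag[of 2] C1[of 2] C0[of 3] anti[of 1 2] anti[of 0 3] by simp_all
    ultimately show ?thesis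
      using cocycle[of "- 2" 3 2] anti[of 2 "- 2"] anti[of 3 "- 2"] anti[of 2 3] C1[of 2]
      by simp
  qed
  have ge2: "C i 2 = 0" if "- 2 \<le> i" for i
    using that
  proof (induction i rule: int_ge_induct)
    case (step i)
    then show ?case using r2[of "i + 1"]
      by (smt (verit) mult_eq_0_iff of_int_eq_0_iff add_diff_cancel_right' mult_zero_right)
  qed fact
  have C2: "C i 2 = 0" for i
  proof (cases "- 2 \<le> i")
    case False
    then have "i \<le> - 3" by simp
    then show ?thesis
    proof (induction i rule: int_le_induct)
      case base
      then show ?case using r2[of "- 2"] ge2[of "- 2"] by simp
    next
      case (step i)
      then show ?case using r2[of i] by (simp add: add_eq_0_iff flip: of_int_add)
    qed
  qed (rule ge2)
  have pos: "C i j = 0" if "2 \<le> j" for i j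
    using that
  proof (induction j arbitrary: i rule: int_ge_induct)
    case (step j)
    then show ?case using up[of i j] by simp
  qed (rule C2)
  have Cm2: "C i (- 2) = 0" for i
  proof -
    have "C i (- 2) = 0" if "i \<le> 1" for i
      using that
    proof (induction i rule: int_le_induct)
      case base
      then show ?case using C1[of "- 2"] anti[of 1 "- 2"] by simp
    next
      case (step i)
      then show ?case using rm2[of "i - 1"]
        by (smt (verit) mult_eq_0_iff of_int_eq_0_iff diff_add_cancel mult_zero_right)
    qed
    moreover have "C i (- 2) = 0" if "2 \<le> i" for i
      using that
    proof (induction i rule: int_ge_induct)
      case base
      then show ?case using C2[of "- 2"] anti[of 2 "- 2"] by simp
    next
      case (step i)
      then show ?case using rm2[of i]
        by (smt (verit) mult_eq_0_iff of_int_eq_0_iff mult_zero_right)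
    qed
    ultimately show ?thesis by (cases "i \<le> 1") auto
  qed
  have neg: "C i j = 0" if "j \<le> - 2" for i j
    using that
  proof (induction j arbitrary: i rule: int_le_induct)
    case (step j)
    then have "of_int (j + 1) * C i (j - 1) = 0" using down[of i j] by simp
    with step.hyps show ?case
      by (smt (verit) mult_eq_0_iff of_int_eq_0_iff)
  qed (rule Cm2)
  consider "j \<le> - 2" | "j = - 1" | "j = 0" | "j = 1" | "2 \<le> j" by linarith
  then show ?thesis using neg Cm1 C0 C1 pos by cases auto
qed

lemma (in degree_cocycle) zero_degree_coboundary:
  assumes "d = 0"
  shows "\<exists>b. \<forall>i j. C i j = of_int (j - i) * (b i + b j - b (i + j))"
proof -
  \<comment> \<open>\<open>B i 1 = 0\<close> prescribes the differences of \<open>b\<close> except \<open>b 2 - b 1\<close>; this leaves the value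
    \<open>\<beta> = b 2\<close> free to arrange \<open>B 2 (-1) = 0\<close>.\<close>
  define g where "g i = C i 1 / of_int (1 - i)" for i
  define \<beta> where "\<beta> = C (- 1) 2 / 3 - (\<Sum>m\<in>{- 1..<1}. g m)"
  define b where "b i = (if i \<le> 1 then \<Sum>m\<in>{i..<1}. g m else \<beta> - (\<Sum>m\<in>{2..<i}. g m))" for i
  have b_succ: "b i - b (i + 1) = g i" if "i \<noteq> 1" for i
  proof (cases "i < 1")
    case True
    then have "{i..<1} = insert i {i + 1..<1}" by auto
    with True show ?thesis by (simp add: b_def)
  next
    case False
    then have "{2..<i + 1} = insert i {2..<i}" using that by auto
    with False that show ?thesis by (simp add: b_def)
  qed
  define B where "B i j = C i j - of_int (j - i) * (b i + b j - b (i + j))" for i j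
  have "B i j = 0" for i j
  proof (rule normalized_degree_zero_cocycle_eq_0)
    show "degree_cocycle 0 B"
    proof
      show "B i j = - B j i" for i j
        using anti[of i j] by (simp add: B_def algebra_simps)
      show "of_int (j + k + 0 - i) * B j k + of_int (i + j + 0 - k) * B i j
      - of_int (i + k + 0 - j) * B i k + of_int (k - j) * B i (j + k)
      - of_int (j - i) * B (i + j) k + of_int (k - i) * B (i + k) j = 0" for i j k
        using cocycle[of j k i] assms by (simp add: B_def algebra_simps)
    qed
    have b1: "b 1 = 0" by (simp add: b_def)
    have diag: "C 1 1 = 0" using anti[of 1 1] by simp
    show "B i 1 = 0" for i
      using b_succ[of i] by (cases "i = 1") (simp_all add: B_def b1 diag g_def field_simps)
    have "b 2 = \<beta>" "b (- 1) = (\<Sum>m\<in>{- 1..<1}. g m)"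
      by (simp_all add: b_def)
    then have "C (- 1) 2 = 3 * (b (- 1) + b 2)" by (simp add: \<beta>_def)
    then show "B 2 (- 1) = 0" using anti[of 2 "- 1"] b1 by (simp add: B_def)
  qed
  then show ?thesis by (auto simp: B_def)
qed

section \<open>Coordinates on the Witt algebra\<close>

lemma lookup_single_mult:
  fixes p :: laurent_poly
  shows "Poly_Mapping.lookup (Poly_Mapping.single n a * p) k = a * Poly_Mapping.lookup p (k - n)"
proof -
  have "k = n + q \<longleftrightarrow> q = k - n" for q by auto
  then show ?thesis by (simp add: lookup_mult lookup_single when_mult)
qed

lemma laurent_induct [case_names zero single add]:
  fixes p :: laurent_poly
  assumes "P 0" and "\<And>n a. P (Poly_Mapping.single n a)"
    and "\<And>p q. P p \<Longrightarrow> P q \<Longrightarrow> P (p + q)"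
  shows "P p"
proof -
  have "p = (\<Sum>n\<in>Poly_Mapping.keys p. Poly_Mapping.single n (Poly_Mapping.lookup p n))"
    by (rule poly_mapping_eqI)
      (simp add: lookup_sum lookup_single when_def sum.delta in_keys_iff)
  moreover have "P (\<Sum>n\<in>N. Poly_Mapping.single n (Poly_Mapping.lookup p n))" if "finite N" for N
    using that by (induction N) (auto intro: assms)
  ultimately show ?thesis by (metis finite_keys)
qed

lemma lookup_laurent_scale [simp]:
  "Poly_Mapping.lookup (laurent_scale c p) n = c * Poly_Mapping.lookup p n"
  by (simp add: laurent_scale_def lookup_single_mult)

lift_definition laurent_deriv :: "laurent_poly \<Rightarrow> laurent_poly"
  is "\<lambda>f n. of_int (n + 1) * f (n + 1)"
proof -
  fix f :: "int \<Rightarrow> complex"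
  assume "finite {n. f n \<noteq> 0}"
  then show "finite {n. of_int (n + 1) * f (n + 1) \<noteq> 0}"
    by (rule finite_surj[where f = "\<lambda>n. n - 1"]) (auto intro: image_eqI[where x = "_ + 1"])
qed

lemma laurent_deriv_single:
  "laurent_deriv (Poly_Mapping.single n a) = Poly_Mapping.single (n - 1) (of_int n * a)"
  by (rule poly_mapping_eqI) (auto simp: laurent_deriv.rep_eq lookup_single when_def)

lemma laurent_deriv_0 [simp]: "laurent_deriv 0 = 0"
  by (rule poly_mapping_eqI) (simp add: laurent_deriv.rep_eq)

lemma laurent_deriv_add: "laurent_deriv (p + q) = laurent_deriv p + laurent_deriv q"
  by (rule poly_mapping_eqI) (simp add: laurent_deriv.rep_eq lookup_add algebra_simps)

lemma laurent_deriv_mult: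
  "laurent_deriv (p * q) = laurent_deriv p * q + p * laurent_deriv q"
proof (induction p rule: laurent_induct)
  case zero
  show ?case by simp
next
  case (single n a)
  show ?case
    by (rule poly_mapping_eqI)
      (simp add: laurent_deriv_single laurent_deriv.rep_eq lookup_add lookup_single_mult,
        simp add: algebra_simps)
next
  case (add p p')
  then show ?case by (simp add: laurent_deriv_add algebra_simps)
qed

lemma laurent_derivation_deriv: "laurent_derivation (\<lambda>p. f * laurent_deriv p)"
proof -
  have "laurent_deriv (laurent_scale c p) = laurent_scale c (laurent_deriv p)" for p c
    by (rule poly_mapping_eqI) (simp add: laurent_deriv.rep_eq)
  then show ?thesis
    by (simp add: laurent_derivation_iff laurent_deriv_add laurent_deriv_mult laurent_scale_mult algebra_simps)
qed

section \<open>Derivations as vector fields f d/dz\<close>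

lift_definition vector_field :: "laurent_poly \<Rightarrow> witt" is "\<lambda>f p. f * laurent_deriv p"
  by (rule laurent_derivation_deriv)

text \<open>The field f d/dz sends z to f, and \<open>e\<^sub>n\<close> has f = z^(n+1); hence the
  evaluation at the variable and the shift by one.\<close>

definition coef :: "witt \<Rightarrow> int \<Rightarrow> complex"
  where "coef w n = Poly_Mapping.lookup (witt_apply w (Poly_Mapping.single 1 1)) (n + 1)"

lemma coef_simps [simp]:
  "coef (v + w) n = coef v n + coef w n"
  "coef (v - w) n = coef v n - coef w n"
  "coef (- w) n = - coef w n"
  "coef 0 n = 0"
  "coef (witt_scale c w) n = c * coef w n"
  and coef_vector_field: "coef (vector_field f) n = Poly_Mapping.lookup f (n + 1)"
  by (simp_all add: coef_def plus_witt.rep_eq minus_witt.rep_eq uminus_witt.rep_eq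
      zero_witt.rep_eq witt_scale.rep_eq vector_field.rep_eq lookup_add lookup_minus
      laurent_deriv_single)

lemma finite_coef: "finite {n. coef w n \<noteq> 0}"
proof -
  have "finite {n. Poly_Mapping.lookup (witt_apply w (Poly_Mapping.single 1 1)) n \<noteq> 0}"
    by simp
  then show ?thesis
    by (rule finite_surj[where f = "\<lambda>n. n - 1"])
      (auto simp: coef_def intro: image_eqI[where x = "_ + 1"])
qed

text \<open>The product rule gives D(z^(n+1)) = D(z^n) z. As z is invertible, vanishing spreads from
  n = 1 to all powers in both directions.\<close>

lemma laurent_derivation_eq_0:
  assumes "laurent_derivation D" and z: "D (Poly_Mapping.single 1 1) = 0"
  shows "D p = 0"
proof -
  have add: "D (p + q) = D p + D q" and scale: "D (laurent_scale c p) = laurent_scale c (D p)"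
    and mult: "D (p * q) = D p * q + p * D q" for p q c
    using assms(1) by (auto simp: laurent_derivation_iff)
  have succ: "D (Poly_Mapping.single (n + 1) 1)
      = D (Poly_Mapping.single n 1) * Poly_Mapping.single 1 1" for n
    using mult[of "Poly_Mapping.single n 1" "Poly_Mapping.single 1 1"] z by (simp add: mult_single)
  have power: "D (Poly_Mapping.single n 1) = 0" for n
  proof (induction n rule: int_induct[where k = 1])
    case (step2 n)
    have "D (Poly_Mapping.single (n - 1) 1)
      = D (Poly_Mapping.single n 1) * Poly_Mapping.single (- 1) 1"
      using succ[of "n - 1"] by (simp add: mult.assoc mult_single)
    then show ?case using step2 by simp
  qed (use z succ in auto)
  show ?thesis
  proof (induction p rule: laurent_induct)
    case (single n a)
    show ?case using scale[of a "Poly_Mapping.single n 1"] power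
      by (simp add: laurent_scale_def mult_single)
  qed (use add[of 0 0] add in auto)
qed

lemma witt_eqI:
  assumes "\<And>n. coef v n = coef w n"
  shows "v = w"
proof -
  have "witt_apply (v - w) (Poly_Mapping.single 1 1) = 0"
  proof (rule poly_mapping_eqI)
    show "Poly_Mapping.lookup (witt_apply (v - w) (Poly_Mapping.single 1 1)) n
        = Poly_Mapping.lookup 0 n" for n
      using assms[of "n - 1"] by (simp add: coef_def minus_witt.rep_eq lookup_minus)
  qed
  then have "witt_apply (v - w) p = 0" for p
    using laurent_derivation_eq_0 witt_apply by blast
  then have "v - w = 0" by (simp add: fun_eq_iff zero_witt.rep_eq flip: witt_apply_inject)
  then show ?thesis by simp
qed

lemma vector_field_apply: "vector_field (witt_apply w (Poly_Mapping.single 1 1)) = w"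
  by (rule witt_eqI) (simp add: coef_vector_field, simp add: coef_def)

lemma witt_apply_eq: "witt_apply w p = witt_apply w (Poly_Mapping.single 1 1) * laurent_deriv p"
  by (metis vector_field.rep_eq vector_field_apply)

definition basis :: "int \<Rightarrow> witt"
  where "basis n = vector_field (Poly_Mapping.single (n + 1) 1)"

lemma coef_basis: "coef (basis n) m = (if m = n then 1 else 0)"
  by (simp add: basis_def coef_vector_field lookup_single when_def)

text \<open>Only the \<open>e\<^sub>m\<close> component of \<open>w\<close> with m = n - i
  contributes, with factor m - i = n - 2i. The proof evaluates the commutator at z.\<close>

lemma coef_bracket_basis:
  "coef (witt_bracket (basis i) w) n = of_int (n - 2 * i) * coef w (n - i)"
  "coef (witt_bracket w (basis i)) n = - of_int (n - 2 * i) * coef w (n - i)"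
proof -
  define f where "f = witt_apply w (Poly_Mapping.single 1 1)"
  have "witt_apply w (Poly_Mapping.single (i + 1) 1)
      = Poly_Mapping.single i (of_int (i + 1)) * f"
    using witt_apply_eq[of w "Poly_Mapping.single (i + 1) 1"]
    by (simp add: f_def laurent_deriv_single mult.commute)
  then show *: "coef (witt_bracket (basis i) w) n = of_int (n - 2 * i) * coef w (n - i)" for n
    by (simp add: coef_def witt_bracket.rep_eq basis_def vector_field.rep_eq lookup_minus
        laurent_deriv_single lookup_single_mult laurent_deriv.rep_eq f_def[symmetric])
      (simp add: algebra_simps)
  have "witt_bracket w v = - witt_bracket v w" for v
    by transfer (simp add: fun_eq_iff)
  then show "coef (witt_bracket w (basis i)) n = - of_int (n - 2 * i) * coef w (n - i)"
    by (simp add: * left_diff_distrib)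
qed

lemma bracket_basis_basis:
  "witt_bracket (basis i) (basis j) = witt_scale (of_int (j - i)) (basis (i + j))"
  by (rule witt_eqI)
    (auto simp: coef_bracket_basis coef_basis)

section \<open>Linear maps and vectors given by coordinates\<close>

lemma linear_eq_on_basis:
  assumes "Vector_Spaces.linear witt_scale witt_scale f"
    and "Vector_Spaces.linear witt_scale witt_scale g"
    and "\<And>n. f (basis n) = g (basis n)"
  shows "f w = g w"
proof -
  have "f (vector_field p) = g (vector_field p)" for p
  proof (induction p rule: laurent_induct)
    case zero
    have "vector_field 0 = witt_scale 0 0" by (rule witt_eqI) (simp add: coef_vector_field)
    moreover have "h (witt_scale 0 0) = 0" if "Vector_Spaces.linear witt_scale witt_scale h" for h
      using that unfolding witt.linear_scale_iff by (metis witt.scale_zero_left)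
    ultimately show ?case using assms by metis
  next
    case (single n a)
    have "vector_field (Poly_Mapping.single n a) = witt_scale a (basis (n - 1))"
      by (rule witt_eqI) (auto simp: coef_vector_field coef_basis lookup_single when_def)
    with assms show ?case by (simp add: witt.linear_scale_iff)
  next
    case (add p q)
    have "vector_field (p + q) = vector_field p + vector_field q"
      by (rule witt_eqI) (simp add: coef_vector_field lookup_add)
    with add assms show ?case by (simp add: witt.linear_scale_iff)
  qed
  then show ?thesis by (metis vector_field_apply)
qed

lemma linear_extension_basis:
  "\<exists>f. Vector_Spaces.linear witt_scale witt_scale f \<and> (\<forall>n. f (basis n) = b n)"
proof -
  \<comment> \<open>The exponent \<open>n\<close> of the coefficient function belongs to
    \<open>basis (n - 1)\<close>.\<close>
  define f where "f w = (\<Sum>n\<in>Poly_Mapping.keys (witt_apply w (Poly_Mapping.single 1 1)).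
    witt_scale (Poly_Mapping.lookup (witt_apply w (Poly_Mapping.single 1 1)) n) (b (n - 1)))" for w
  have "f (v + w) = f v + f w" for v w
    unfolding f_def plus_witt.rep_eq
    by (rule setsum_keys_plus_distrib) (simp_all add: witt.scale_left_distrib)
  moreover have "f (witt_scale c w) = witt_scale c (f w)" for c w
  proof (cases "c = 0")
    case True
    then show ?thesis by (simp add: f_def zero_witt.rep_eq)
  next
    case False
    then have "Poly_Mapping.keys (laurent_scale c p) = Poly_Mapping.keys p" for p
      by (auto simp: in_keys_iff)
    then show ?thesis by (simp add: f_def witt_scale.rep_eq witt.scale_sum_right)
  qed
  moreover have "f (basis n) = b n" for n
    by (simp add: f_def basis_def vector_field.rep_eq laurent_deriv_single)
  ultimately show ?thesis by (auto simp: witt.linear_scale_iff)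
qed

lemma witt_with_coef:
  assumes "finite {n. a n \<noteq> 0}"
  shows "\<exists>w. \<forall>n. coef w n = a n"
proof -
  have "finite {n. a (n - 1) \<noteq> 0}"
    using assms
    by (rule finite_surj[where f = "\<lambda>n. n + 1"]) (auto intro: image_eqI[where x = "_ - 1"])
  then have "coef (vector_field (Abs_poly_mapping (\<lambda>n. a (n - 1)))) n = a n" for n
    by (simp add: coef_vector_field)
  then show ?thesis by blast
qed

section \<open>Derivations and cocycles of the Witt algebra\<close>

lemma coef_bracket_basis_shift:
  "coef (witt_bracket (basis i) w) (i + m) = of_int (m - i) * coef w m"
  "coef (witt_bracket w (basis i)) (i + m) = of_int (i - m) * coef w m"
  by (simp_all add: coef_bracket_basis)

text \<open>Bracketing with any \<open>e\<^sub>i\<close>, i different from n, detects coefficient n;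
  i = n + 1 makes the factor -1.\<close>

lemma witt_centre_trivial:
  assumes "\<And>x. witt_bracket x w = 0"
  shows "w = 0"
proof (rule witt_eqI)
  fix n
  have "of_int (n - (n + 1)) * coef w n = 0"
    using assms[of "basis (n + 1)"] coef_bracket_basis_shift(1)[of "n + 1" w n] by simp
  then show "coef w n = coef 0 n" by simp
qed

lemma bilinear_eq_on_basis:
  assumes "bilinear_map witt_scale f" and "bilinear_map witt_scale g"
    and "\<And>i j. f (basis i) (basis j) = g (basis i) (basis j)"
  shows "f = g"
proof -
  have basis: "f (basis i) y = g (basis i) y" for i y
    by (rule linear_eq_on_basis) (use assms in \<open>auto simp: bilinear_map_def\<close>)
  have "f x y = g x y" for x y
    by (rule linear_eq_on_basis[of "\<lambda>x. f x y" "\<lambda>x. g x y"])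
      (use assms basis in \<open>auto simp: bilinear_map_def\<close>)
  then show ?thesis by (simp add: fun_eq_iff)
qed

lemma witt_derivation_inner:
  assumes "D \<in> witt.ZL1"
  shows "D \<in> witt.BL1"
proof -
  have lin: "Vector_Spaces.linear witt_scale witt_scale D"
    and der: "D (witt_bracket x y) = witt_bracket (D x) y + witt_bracket x (D y)" for x y
    using assms by (auto simp: witt.ZL1_def)
  define c where "c d i = coef (D (basis i)) (i + d)" for d i
  have rel: "of_int (j - i) * c d (i + j) = of_int (j + d - i) * c d j + of_int (j - i - d) * c d i"
    for d i j
  proof -
    have "coef (D (witt_bracket (basis i) (basis j))) (i + j + d) = of_int (j - i) * c d (i + j)"
      using lin by (simp add: bracket_basis_basis witt.linear_scale_iff c_def)
    moreover have "coef (witt_bracket (D (basis i)) (basis j)) (i + j + d)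
        = of_int (j - i - d) * c d i"
      using coef_bracket_basis_shift(2)[of "D (basis i)" j "i + d"] by (simp add: c_def algebra_simps)
    moreover have "coef (witt_bracket (basis i) (D (basis j))) (i + j + d)
        = of_int (j + d - i) * c d j"
      using coef_bracket_basis_shift(1)[of i "D (basis j)" "j + d"] by (simp add: c_def algebra_simps)
    ultimately show ?thesis using der[of "basis i" "basis j"] by (simp add: add.commute)
  qed
  \<comment> \<open>Being the bracket with a vector of coefficients \<open>a d\<close> means
    \<open>c d i = (d - i) * a d\<close>. This is solved at \<open>i = 0\<close> if \<open>d\<close>
    is nonzero, and at \<open>i = 1\<close> if \<open>d = 0\<close>.\<close>
  define a where "a d = (if d = 0 then - c 0 1 else c d 0 / of_int d)" for d
  have inner: "c d i = of_int (d - i) * a d" for d i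
  proof (cases "d = 0")
    case True
    have "c 0 i = of_int i * c 0 1"
    proof (rule additive_on_distinct_int)
      show "of_int (j - i) * (c 0 (i + j) - c 0 i - c 0 j) = 0" for i j
        using rel[of j i 0] by (simp add: algebra_simps)
    qed
    with True show ?thesis by (simp add: a_def)
  next
    case False
    have "of_int d * c d i = of_int (d - i) * c d 0"
      using rel[of 0 i d] by (simp add: algebra_simps)
    with False show ?thesis by (simp add: a_def field_simps)
  qed
  have "finite {d. a d \<noteq> 0}"
  proof (rule finite_subset)
    show "{d. a d \<noteq> 0} \<subseteq> insert 0 {d. coef (D (basis 0)) d \<noteq> 0}"
      by (auto simp: a_def c_def split: if_splits)
  qed (simp add: finite_coef)
  then obtain w where w: "\<And>d. coef w d = a d"
    using witt_with_coef by blast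
  have "D (basis i) = witt_bracket (basis i) w" for i
  proof (rule witt_eqI)
    fix n
    show "coef (D (basis i)) n = coef (witt_bracket (basis i) w) n"
      using inner[of "n - i" i] coef_bracket_basis(1)[of i w n] by (simp add: c_def w)
  qed
  then have "D x = witt_bracket x w" for x
    using linear_eq_on_basis[OF lin witt.linear_bracket(2)] by blast
  then show ?thesis by (auto simp: witt.BL1_def)
qed

lemma witt_leibniz_cocycle_alternating:
  assumes "f \<in> witt.ZL2"
  shows "f x y = - f y x"
proof -
  have add: "f (x + y) z = f x z + f y z" "f z (x + y) = f z x + f z y" for x y z
    using assms by (auto simp: witt.ZL2_def bilinear_map_def witt.linear_scale_iff)
  have cocycle: "witt_bracket x (f y z) - witt_bracket (f x y) z + witt_bracket (f x z) y
      + f x (witt_bracket y z) - f (witt_bracket x y) z + f (witt_bracket x z) y = 0" for x y z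
    using assms by (auto simp: witt.ZL2_def)
  have diag: "f y y = 0" for y
  proof (rule witt_centre_trivial)
    have "witt_bracket y y = 0" by transfer simp
    \<comment> \<open>The remaining terms cancel in pairs, except \<open>f x 0\<close>, which
      vanishes by additivity at 0.\<close>
    then show "witt_bracket x (f y y) = 0" for x
      using cocycle[of x y y] add(2)[of x 0 0] by simp
  qed
  have "f (x + y) (x + y) = f x y + f y x"
    unfolding add by (simp add: diag)
  then have "f x y + f y x = 0" by (simp only: diag)
  then show ?thesis by (simp add: add_eq_0_iff2)
qed

lemma witt_leibniz_cocycle_coboundary:
  assumes "f \<in> witt.ZL2"
  shows "f \<in> witt.BL2"
proof -
  have bil: "bilinear_map witt_scale f"
    and cocycle: "witt_bracket x (f y z) - witt_bracket (f x y) z + witt_bracket (f x z) y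
      + f x (witt_bracket y z) - f (witt_bracket x y) z + f (witt_bracket x z) y = 0" for x y z
    using assms by (auto simp: witt.ZL2_def)
  have scale: "f (witt_scale a x) y = witt_scale a (f x y)"
    "f x (witt_scale a y) = witt_scale a (f x y)" for a x y
    using bil by (auto simp: bilinear_map_def witt.linear_scale_iff)
  define C where "C d i j = coef (f (basis i) (basis j)) (i + j + d)" for d i j
  have cocycle_C: "degree_cocycle d (C d)" for d
  proof
    fix i j k
    show "C d i j = - C d j i"
      using witt_leibniz_cocycle_alternating[OF assms, of "basis i" "basis j"]
      by (simp add: C_def add.commute)
    let ?n = "i + j + k + d"
    have left: "coef (witt_bracket (basis i) (f (basis j) (basis k))) ?n
        = of_int (j + k + d - i) * C d j k"
      using coef_bracket_basis_shift(1)[of i "f (basis j) (basis k)" "j + k + d"]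
      by (simp add: C_def add_ac)
    \<comment> \<open>Two terms have this shape, with \<open>j\<close> and \<open>k\<close>
      exchanged; hence the general indices of fixed sum.\<close>
    have right: "coef (witt_bracket (f (basis l) (basis m)) (basis r)) ?n
        = - (of_int (l + m + d - r) * C d l m)" if "l + m + r = i + j + k" for l m r
      using coef_bracket_basis_shift(2)[of "f (basis l) (basis m)" r "l + m + d"] that
      by (simp add: C_def algebra_simps)
    have inside: "coef (f (basis i) (witt_bracket (basis j) (basis k))) ?n
        = of_int (k - j) * C d i (j + k)"
      "coef (f (witt_bracket (basis i) (basis j)) (basis k)) ?n
        = of_int (j - i) * C d (i + j) k"
      "coef (f (witt_bracket (basis i) (basis k)) (basis j)) ?n
        = of_int (k - i) * C d (i + k) j"
      by (simp_all add: bracket_basis_basis scale C_def add_ac)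
    show "of_int (j + k + d - i) * C d j k + of_int (i + j + d - k) * C d i j
      - of_int (i + k + d - j) * C d i k + of_int (k - j) * C d i (j + k)
      - of_int (j - i) * C d (i + j) k + of_int (k - i) * C d (i + k) j = 0"
      using arg_cong[OF cocycle[of "basis i" "basis j" "basis k"], of "\<lambda>w. coef w ?n"]
        right[of i j k] right[of i k j]
      by (simp add: left inside)
  qed
  obtain b\<^sub>0 where b\<^sub>0: "\<And>i j. C 0 i j = of_int (j - i) * (b\<^sub>0 i + b\<^sub>0 j - b\<^sub>0 (i + j))"
    using degree_cocycle.zero_degree_coboundary[OF cocycle_C] by blast
  define b where "b d i = (if d = 0 then b\<^sub>0 i else - C d i 0 / of_int d)" for d i
  have C: "C d i j = of_int (j + d - i) * b d j - of_int (i + d - j) * b d i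
      - of_int (j - i) * b d (i + j)" for d i j
  proof (cases "d = 0")
    case True
    then show ?thesis using b\<^sub>0[of i j] by (simp add: b_def algebra_simps)
  next
    case False
    then show ?thesis
      using degree_cocycle.nonzero_degree_coboundary[OF cocycle_C False, of i j]
      by (simp add: b_def)
  qed
  have "\<exists>w. \<forall>n. coef w n = b (n - i) i" for i
  proof (rule witt_with_coef, rule finite_subset)
    \<comment> \<open>Degree 0 contributes to \<open>w i\<close> only at \<open>n = i\<close>, so
      nothing need be known about \<open>b\<^sub>0\<close>.\<close>
    show "{n. b (n - i) i \<noteq> 0} \<subseteq> insert i {n. coef (f (basis i) (basis 0)) n \<noteq> 0}"
      by (auto simp: b_def C_def)
  qed (simp add: finite_coef)
  then obtain w where w: "\<And>i n. coef (w i) n = b (n - i) i" by metis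
  obtain \<psi> where lin: "Vector_Spaces.linear witt_scale witt_scale \<psi>"
    and \<psi>: "\<And>i. \<psi> (basis i) = w i"
    using linear_extension_basis by blast
  define g where "g = (\<lambda>x y. witt_bracket (\<psi> x) y + witt_bracket x (\<psi> y) - \<psi> (witt_bracket x y))"
  have g: "g \<in> witt.BL2"
    using lin by (auto simp: witt.BL2_def g_def)
  have "f = g"
  proof (rule bilinear_eq_on_basis)
    show "bilinear_map witt_scale g"
      using g witt.BL2_subset_ZL2 by (auto simp: witt.ZL2_def)
    show "f (basis i) (basis j) = g (basis i) (basis j)" for i j
    proof (rule witt_eqI)
      fix n
      have "coef (\<psi> (witt_bracket (basis i) (basis j))) n
          = of_int (j - i) * b (n - (i + j)) (i + j)"
        using lin by (simp add: bracket_basis_basis witt.linear_scale_iff \<psi> w)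
      then have "coef (g (basis i) (basis j)) n
          = of_int (n - 2 * i) * b (n - i - j) j + of_int (2 * j - n) * b (n - j - i) i
            - of_int (j - i) * b (n - (i + j)) (i + j)"
        by (simp add: g_def \<psi> coef_bracket_basis w)
      then show "coef (f (basis i) (basis j)) n = coef (g (basis i) (basis j)) n"
        using C[of "n - i - j" i j]
        by (simp add: C_def diff_diff_eq diff_diff_eq2 add.commute)
          (simp add: left_diff_distrib)
    qed
  qed (rule bil)
  with g show ?thesis by simp
qed

text \<open>Once all cocycles are coboundaries, the relation defining the cohomology is total on
  them, and a single class remains.\<close>

lemma quotient_Times_self:
  assumes "A \<noteq> {}"
  shows "A // (A \<times> A) = {A}"
  using assms by (auto simp: quotient_def)

theorem theorem4: "witt.HL1 = {witt.BL1} \<and> witt.HL2 = {witt.BL2}"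
proof
  have ZL1: "witt.ZL1 = witt.BL1"
    using witt_derivation_inner witt.BL1_subset_ZL1 by blast
  have ZL2: "witt.ZL2 = witt.BL2"
    using witt_leibniz_cocycle_coboundary witt.BL2_subset_ZL2 by blast
  have diff1: "(\<lambda>x. f x - g x) \<in> witt.BL1" if fg: "f \<in> witt.BL1" "g \<in> witt.BL1" for f g
  proof -
    obtain a b where "f = (\<lambda>x. witt_bracket x a)" "g = (\<lambda>x. witt_bracket x b)"
      using fg by (auto simp: witt.BL1_def)
    then show ?thesis
      by (auto simp: witt.BL1_def witt.bracket_simps intro: exI[of _ "a - b"])
  qed
  have diff2: "(\<lambda>x y. f x y - g x y) \<in> witt.BL2" if fg: "f \<in> witt.BL2" "g \<in> witt.BL2" for f g
  proof -
    obtain d e where d: "Vector_Spaces.linear witt_scale witt_scale d"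
      "f = (\<lambda>x y. witt_bracket (d x) y + witt_bracket x (d y) - d (witt_bracket x y))"
      and e: "Vector_Spaces.linear witt_scale witt_scale e"
      "g = (\<lambda>x y. witt_bracket (e x) y + witt_bracket x (e y) - e (witt_bracket x y))"
      using fg by (auto simp: witt.BL2_def)
    have "Vector_Spaces.linear witt_scale witt_scale (\<lambda>x. d x - e x)"
      using d(1) e(1) by (simp add: witt.linear_scale_iff witt.scale_right_diff_distrib)
    moreover have "(\<lambda>x y. f x y - g x y) = (\<lambda>x y. witt_bracket (d x - e x) y
        + witt_bracket x (d y - e y) - (d (witt_bracket x y) - e (witt_bracket x y)))"
      by (simp add: d(2) e(2) witt.bracket_simps algebra_simps)
    ultimately show ?thesis unfolding witt.BL2_def by blast
  qed
  have ne: "witt.BL1 \<noteq> {}" "witt.BL2 \<noteq> {}"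
    using witt.BL1_def witt.BL2_def witt.linear_bracket(2) by blast+
  have "{(f, g). f \<in> witt.BL1 \<and> g \<in> witt.BL1 \<and> (\<lambda>x. f x - g x) \<in> witt.BL1}
      = witt.BL1 \<times> witt.BL1"
    using diff1 by blast
  then show "witt.HL1 = {witt.BL1}"
    using ne by (simp add: witt.HL1_def ZL1 quotient_Times_self)
  have "{(f, g). f \<in> witt.BL2 \<and> g \<in> witt.BL2 \<and> (\<lambda>x y. f x y - g x y) \<in> witt.BL2}
      = witt.BL2 \<times> witt.BL2"
    using diff2 by blast
  then show "witt.HL2 = {witt.BL2}"
    using ne by (simp add: witt.HL2_def ZL2 quotient_Times_self)
qed

end
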